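(* For every integer $d\geq4$ there exist a cancellative monoid $\mathsf{S}$ (with neutral element $e$) and an associative algebra $\mathfrak{A}$ over a field, with an $\mathsf{S}$-grading of order $d$, such that $\mathfrak{A}_e$ is central in $\mathfrak{A}$ but, for every $m\in\mathbb{N}$, the polynomial $[x_1,\dots,x_m]$ is not a polynomial identity for $\mathfrak{A}$.
   Context: A monoid is cancellative if $\xi\zeta=\tau\zeta$ implies $\xi=\tau$ and $\zeta\xi=\zeta\tau$ implies $\xi=\tau$. An $\mathsf{S}$-grading on $\mathfrak{A}$ is a decomposition $\mathfrak{A}=\bigoplus_{\xi\in\mathsf{S}}\mathfrak{A}_\xi$ into subspaces with $\mathfrak{A}_\xi\mathfrak{A}_\zeta\subseteq\mathfrak{A}_{\xi\zeta}$; it has order $d$ if its support $\{\xi\in\mathsf{S}:\mathfrak{A}_\xi\neq\{0\}\}$ has exactly $d$ elements. Commutators are left-normed: $[x_1,x_2]=x_1x_2-x_2x_1$, $[x_1,\dots,x_m]=[[x_1,\dots,x_{m-1}],x_m]$ (with $[x_1]=x_1$). A polynomial is an identity for $\mathfrak{A}$ if it vanishes on all elements of $\mathfrak{A}$. *)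

theory Defs
  imports Complex_Main "HOL-Algebra.Algebra"
begin

text \<open>
  The library locale \<open>algebra\<close> covers commutative algebras only; this is the same
  locale with \<open>cring M\<close> relaxed to \<open>ring M\<close>.  Without commutativity,
  compatibility with scalars has to be required in both factors.
\<close>

locale associative_algebra = module K A + ring A
  for K :: "('k, 'm) ring_scheme" and A :: "('k, 'a, 'n) module_scheme" +
  assumes smult_mult_left:
      "\<lbrakk>c \<in> carrier K; x \<in> carrier A; y \<in> carrier A\<rbrakk>
        \<Longrightarrow> (c \<odot>\<^bsub>A\<^esub> x) \<otimes>\<^bsub>A\<^esub> y = c \<odot>\<^bsub>A\<^esub> (x \<otimes>\<^bsub>A\<^esub> y)"
    and smult_mult_right:
      "\<lbrakk>c \<in> carrier K; x \<in> carrier A; y \<in> carrier A\<rbrakk>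
        \<Longrightarrow> x \<otimes>\<^bsub>A\<^esub> (c \<odot>\<^bsub>A\<^esub> y) = c \<odot>\<^bsub>A\<^esub> (x \<otimes>\<^bsub>A\<^esub> y)"

definition homogeneous_support ::
    "('s, 't) monoid_scheme \<Rightarrow> ('k, 'a, 'n) module_scheme \<Rightarrow> ('s \<Rightarrow> 'a set) \<Rightarrow> 's set" where
  "homogeneous_support S A V = {\<xi> \<in> carrier S. V \<xi> \<noteq> {\<zero>\<^bsub>A\<^esub>}}"

text \<open>
  In \<open>is_grading\<close>, existence and uniqueness of the family \<open>f\<close> of homogeneous
  components say that the carrier is the internal direct sum of the subspaces
  \<open>V \<xi>\<close>.  The sum runs over the nonzero components only, because \<open>finsum\<close> over
  an infinite index set is zero by convention.
\<close>

definition is_grading ::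
    "('s, 't) monoid_scheme \<Rightarrow> ('k, 'm) ring_scheme \<Rightarrow> ('k, 'a, 'n) module_scheme
      \<Rightarrow> ('s \<Rightarrow> 'a set) \<Rightarrow> bool" where
  "is_grading S K A V \<longleftrightarrow>
     (\<forall>\<xi> \<in> carrier S. submodule (V \<xi>) K A) \<and>
     (\<forall>a \<in> carrier A. \<exists>!f. f \<in> (\<Pi>\<^sub>E \<xi> \<in> carrier S. V \<xi>) \<and>
        finite {\<xi> \<in> carrier S. f \<xi> \<noteq> \<zero>\<^bsub>A\<^esub>} \<and>
        a = (\<Oplus>\<^bsub>A\<^esub> \<xi> \<in> {\<xi> \<in> carrier S. f \<xi> \<noteq> \<zero>\<^bsub>A\<^esub>}. f \<xi>)) \<and>
     (\<forall>\<xi> \<in> carrier S. \<forall>\<zeta> \<in> carrier S. \<forall>a \<in> V \<xi>. \<forall>b \<in> V \<zeta>.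
        a \<otimes>\<^bsub>A\<^esub> b \<in> V (\<xi> \<otimes>\<^bsub>S\<^esub> \<zeta>))"

definition has_order ::
    "('s, 't) monoid_scheme \<Rightarrow> ('k, 'a, 'n) module_scheme \<Rightarrow> ('s \<Rightarrow> 'a set) \<Rightarrow> nat \<Rightarrow> bool" where
  "has_order S A V d \<longleftrightarrow>
     finite (homogeneous_support S A V) \<and> card (homogeneous_support S A V) = d"

definition is_central :: "('k, 'a, 'n) module_scheme \<Rightarrow> 'a set \<Rightarrow> bool" where
  "is_central A U \<longleftrightarrow>
     U \<subseteq> carrier A \<and> (\<forall>a \<in> U. \<forall>b \<in> carrier A. a \<otimes>\<^bsub>A\<^esub> b = b \<otimes>\<^bsub>A\<^esub> a)"

text \<open>
  Polynomials in noncommuting indeterminates without constant term are represented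
  by formal expressions; an expression is evaluated in an algebra by substituting
  elements for the indeterminates.
\<close>

datatype 'k nc_polynomial =
    Indet nat
  | Add "'k nc_polynomial" "'k nc_polynomial"
  | Diff "'k nc_polynomial" "'k nc_polynomial"
  | Mult "'k nc_polynomial" "'k nc_polynomial"
  | Scale 'k "'k nc_polynomial"

primrec nc_eval ::
    "('k, 'a, 'n) module_scheme \<Rightarrow> (nat \<Rightarrow> 'a) \<Rightarrow> 'k nc_polynomial \<Rightarrow> 'a" where
  "nc_eval A x (Indet i) = x i"
| "nc_eval A x (Add p q) = nc_eval A x p \<oplus>\<^bsub>A\<^esub> nc_eval A x q"
| "nc_eval A x (Diff p q) = nc_eval A x p \<ominus>\<^bsub>A\<^esub> nc_eval A x q"
| "nc_eval A x (Mult p q) = nc_eval A x p \<otimes>\<^bsub>A\<^esub> nc_eval A x q"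
| "nc_eval A x (Scale c p) = c \<odot>\<^bsub>A\<^esub> nc_eval A x p"

definition polynomial_identity ::
    "('k, 'a, 'n) module_scheme \<Rightarrow> 'k nc_polynomial \<Rightarrow> bool" where
  "polynomial_identity A p \<longleftrightarrow>
     (\<forall>x. (\<forall>i. x i \<in> carrier A) \<longrightarrow> nc_eval A x p = \<zero>\<^bsub>A\<^esub>)"

definition nc_commutator ::
    "'k nc_polynomial \<Rightarrow> 'k nc_polynomial \<Rightarrow> 'k nc_polynomial" where
  "nc_commutator p q = Diff (Mult p q) (Mult q p)"

text \<open>
  \<open>left_normed_commutator m\<close> is $[x_1,\ldots,x_m]$ for $m \ge 1$; the value
  at \<open>0\<close> is left unspecified.
\<close>

fun left_normed_commutator :: "nat \<Rightarrow> 'k nc_polynomial" where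
  "left_normed_commutator (Suc 0) = Indet 1"
| "left_normed_commutator (Suc (Suc m)) =
     nc_commutator (left_normed_commutator (Suc m)) (Indet (Suc (Suc m)))"

end

theory Submission
  imports Defs
begin

text \<open>
  The quaternions \<open>\<H> = \<langle>1, i, j, k\<rangle>\<close> are graded by the Klein four-group, with the scalars,
  which are central, as neutral component. They are not Lie nilpotent: commutation with \<open>j\<close>
  sends \<open>i\<close> to \<open>2k\<close> and \<open>k\<close> to \<open>-2i\<close>, so that \<open>[i, j, \<dots>, j]\<close> never vanishes. This settles
  \<open>d = 4\<close>.

  For larger \<open>d\<close> the support has to be enlarged without spoiling either property. This is done
  with the direct product of \<open>\<H>\<close> and the commutative algebra \<open>\<real> \<oplus> N\<close>, where \<open>N\<^sup>2 = 0\<close> and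
  \<open>dim N = d - 4\<close>. As all products inside \<open>N\<close> vanish, its basis vectors may be given any
  degrees at all. The neutral component becomes \<open>\<real> \<times> \<real>\<close>, which is still central. It would not
  do to let \<open>\<H>\<close> itself act on \<open>N\<close>: \<open>i\<close> and \<open>j\<close> would act invertibly, so the degrees occurring in
  \<open>N\<close> would fill whole cosets of the Klein four-group, and not every \<open>d\<close> would be reached.

  The grading monoid consists of the natural numbers under bitwise exclusive or. It is an
  elementary abelian 2-group in which \<open>{0, 1, 2, 3}\<close> is a Klein four-group, hence the degrees of
  \<open>1, i, j, k\<close>, and it leaves \<open>4, \<dots>, d - 1\<close> as degrees for the basis of \<open>N\<close>.
\<close>

section \<open>The grading monoid\<close>

definition xor_monoid :: "nat monoid" where
  "xor_monoid = \<lparr>carrier = UNIV, monoid.mult = xor, one = 0\<rparr>"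

lemma xor_monoid_cancel: "monoid_cancel xor_monoid"
proof -
  interpret monoid xor_monoid
    by (rule monoidI) (auto simp: xor_monoid_def ac_simps)
  \<comment> \<open>Every element is its own inverse.\<close>
  have cancel: "a = b" if "xor c a = xor c b" for a b c :: nat
    using that by (metis xor.assoc xor_self_eq xor.left_neutral)
  show ?thesis
    by (rule monoid_cancelI) (auto simp: xor_monoid_def, metis cancel, metis cancel xor.commute)
qed

section \<open>The algebra\<close>

definition real_ring :: "real ring" where
  "real_ring = \<lparr>carrier = UNIV, monoid.mult = (*), one = 1, ring.zero = 0, ring.add = (+)\<rparr>"

lemma real_ring_field: "field real_ring"
proof -
  have "\<exists>b. b + a = 0" for a :: real
    by (rule exI[of _ "- a"]) simp
  then have "cring real_ring"
    by (intro cringI abelian_groupI comm_monoidI) (auto simp: real_ring_def algebra_simps)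
  then interpret cring real_ring .
  have "\<exists>b. a * b = 1" if "a \<noteq> 0" for a :: real
    using that by (intro exI[of _ "inverse a"]) simp
  then show ?thesis
    by (intro cring_fieldI2) (auto simp: real_ring_def)
qed

fun quaternion_mult :: "(nat \<Rightarrow> real) \<Rightarrow> (nat \<Rightarrow> real) \<Rightarrow> nat \<Rightarrow> real" where
  "quaternion_mult a b n =
     (if n = 0 then a 0 * b 0 - a 1 * b 1 - a 2 * b 2 - a 3 * b 3
      else if n = 1 then a 0 * b 1 + a 1 * b 0 + a 2 * b 3 - a 3 * b 2
      else if n = 2 then a 0 * b 2 - a 1 * b 3 + a 2 * b 0 + a 3 * b 1
      else a 0 * b 3 + a 1 * b 2 - a 2 * b 1 + a 3 * b 0)"

text \<open>
  In an element of \<open>\<H> \<times> (\<real> \<oplus> N)\<close>, the coordinates \<open>0, \<dots>, 3\<close> are the quaternion,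
  \<open>4, \<dots>, d - 1\<close> the part in \<open>N\<close>, and \<open>d\<close> the scalar summand of \<open>\<real> \<oplus> N\<close>. The scalar is put
  last so that the degree of a coordinate is just its index modulo \<open>d\<close>.
\<close>

definition extended_quaternions :: "nat \<Rightarrow> (real, nat \<Rightarrow> real) module" where
  "extended_quaternions d =
     \<lparr>carrier = {a. \<forall>n>d. a n = 0},
      monoid.mult = (\<lambda>a b n. if n < 4 then quaternion_mult a b n
                      else if n < d then a d * b n + a n * b d
                      else if n = d then a d * b d else 0),
      one = (\<lambda>n. if n = 0 \<or> n = d then 1 else 0),
      ring.zero = (\<lambda>n. 0),
      ring.add = (\<lambda>a b n. a n + b n),
      module.smult = (\<lambda>c a n. c * a n)\<rparr>"

lemma less_4_iff: "n < 4 \<longleftrightarrow> n = 0 \<or> n = 1 \<or> n = 2 \<or> n = 3" for n :: nat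
  by auto

context
  fixes d :: nat
  assumes d: "d \<ge> 4"
begin

abbreviation "A \<equiv> extended_quaternions d"

lemma extended_quaternions_ring: "ring A"
proof (rule ringI)
  have "\<exists>b. (\<forall>n>d. b n = 0) \<and> (\<lambda>n. b n + a n) = (\<lambda>n. 0)" if "\<forall>n>d. a n = 0"
    for a :: "nat \<Rightarrow> real"
    using that by (intro exI[of _ "\<lambda>n. - a n"]) simp
  then show "abelian_group A"
    by (intro abelian_groupI) (auto simp: extended_quaternions_def algebra_simps)
  show "monoid A"
    using d by (intro monoidI) (auto simp: extended_quaternions_def less_4_iff fun_eq_iff algebra_simps)
qed (use d in \<open>auto simp: extended_quaternions_def fun_eq_iff algebra_simps\<close>)

lemma extended_quaternions_algebra: "associative_algebra real_ring A"
proof -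
  interpret ring A by (rule extended_quaternions_ring)
  interpret module real_ring A
    using real_ring_field abelian_group_axioms
    by (intro moduleI)
       (auto simp: field_def domain_def real_ring_def extended_quaternions_def algebra_simps)
  show ?thesis
    using d by unfold_locales
      (auto simp: extended_quaternions_def real_ring_def fun_eq_iff algebra_simps)
qed

lemma a_inv_extended_quaternions:
  assumes "a \<in> carrier A"
  shows "\<ominus>\<^bsub>A\<^esub> a = (\<lambda>n. - a n)"
proof -
  interpret ring A by (rule extended_quaternions_ring)
  show ?thesis
    using assms by (intro minus_equality) (auto simp: extended_quaternions_def)
qed

lemma a_minus_extended_quaternions:
  assumes "a \<in> carrier A" "b \<in> carrier A"
  shows "a \<ominus>\<^bsub>A\<^esub> b = (\<lambda>n. a n - b n)"
  using assms a_inv_extended_quaternions[of b]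
  by (simp add: a_minus_def) (simp add: extended_quaternions_def)

lemma finsum_extended_quaternions:
  assumes "finite I" "f \<in> I \<rightarrow> carrier A"
  shows "(\<Oplus>\<^bsub>A\<^esub>i\<in>I. f i) = (\<lambda>n. \<Sum>i\<in>I. f i n)"
proof -
  interpret ring A by (rule extended_quaternions_ring)
  show ?thesis
    using assms
  proof (induction I rule: finite_induct)
    case empty
    show ?case by (subst finsum_empty) (simp add: extended_quaternions_def)
  next
    case (insert i I)
    then have "(\<Oplus>\<^bsub>A\<^esub>i\<in>insert i I. f i) = f i \<oplus>\<^bsub>A\<^esub> (\<lambda>n. \<Sum>i\<in>I. f i n)"
      by (simp add: Pi_def)
    then show ?case
      using insert.hyps by (simp add: extended_quaternions_def)
  qed
qed

section \<open>The grading\<close>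

definition component :: "nat \<Rightarrow> (nat \<Rightarrow> real) set" where
  "component \<xi> = {a \<in> carrier A. \<forall>n. a n \<noteq> 0 \<longrightarrow> n mod d = \<xi>}"

lemma component_submodule: "submodule (component \<xi>) real_ring A"
proof -
  interpret associative_algebra real_ring A by (rule extended_quaternions_algebra)
  show ?thesis
  proof (rule submoduleI)
    show "\<ominus>\<^bsub>A\<^esub> a \<in> component \<xi>" if "a \<in> component \<xi>" for a
      using that a_inv_closed[of a] a_inv_extended_quaternions[of a]
      by (auto simp: component_def)
    show "a \<oplus>\<^bsub>A\<^esub> b \<in> component \<xi>" if "a \<in> component \<xi>" "b \<in> component \<xi>" for a b
    proof -
      have "n mod d = \<xi>" if "a n + b n \<noteq> 0" for n
        using that \<open>a \<in> component \<xi>\<close> \<open>b \<in> component \<xi>\<close>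
        by (cases "a n = 0") (auto simp: component_def)
      with that show ?thesis
        by (auto simp: component_def extended_quaternions_def)
    qed
  qed (auto simp: component_def extended_quaternions_def)
qed

text \<open>
  Every coordinate \<open>n\<close> belongs to exactly one component, that of degree \<open>n mod d\<close>. Coordinate \<open>n\<close>
  of a sum of homogeneous elements therefore comes from a single summand, which determines
  all summands from the sum.
\<close>

lemma homogeneous_parts_unique:
  assumes f: "f \<in> (\<Pi>\<^sub>E \<xi> \<in> UNIV. component \<xi>)" and fin: "finite {\<xi>. f \<xi> \<noteq> \<zero>\<^bsub>A\<^esub>}"
    and a: "a = (\<Oplus>\<^bsub>A\<^esub> \<xi> \<in> {\<xi>. f \<xi> \<noteq> \<zero>\<^bsub>A\<^esub>}. f \<xi>)"
  shows "f = (\<lambda>\<xi> n. if n mod d = \<xi> then a n else 0)"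
proof (intro ext)
  fix \<xi> n
  let ?T = "{\<xi>. f \<xi> \<noteq> \<zero>\<^bsub>A\<^esub>}"
  have mem: "f \<zeta> \<in> component \<zeta>" for \<zeta>
    using f by auto
  have zero: "f \<zeta> n = 0" if "n mod d \<noteq> \<zeta>" for \<zeta>
    using mem[of \<zeta>] that by (auto simp: component_def)
  have "a n = (\<Sum>\<zeta>\<in>?T. f \<zeta> n)"
    unfolding a using fin mem
    by (subst finsum_extended_quaternions) (auto simp: component_def)
  also have "\<dots> = (\<Sum>\<zeta>\<in>?T. if \<zeta> = n mod d then f \<zeta> n else 0)"
    using zero by (intro sum.cong) auto
  also have "\<dots> = f (n mod d) n"
    using fin by (auto simp: sum.delta) (auto simp: extended_quaternions_def)
  finally show "f \<xi> n = (if n mod d = \<xi> then a n else 0)"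
    using zero by auto
qed

lemma homogeneous_parts_exist:
  assumes a: "a \<in> carrier A"
  defines "f \<equiv> \<lambda>\<xi> n. if n mod d = \<xi> then a n else 0"
  shows "f \<in> (\<Pi>\<^sub>E \<xi> \<in> UNIV. component \<xi>)" "finite {\<xi>. f \<xi> \<noteq> \<zero>\<^bsub>A\<^esub>}"
    "a = (\<Oplus>\<^bsub>A\<^esub> \<xi> \<in> {\<xi>. f \<xi> \<noteq> \<zero>\<^bsub>A\<^esub>}. f \<xi>)"
proof -
  let ?T = "{\<xi>. f \<xi> \<noteq> \<zero>\<^bsub>A\<^esub>}"
  have mem: "f \<xi> \<in> component \<xi>" for \<xi>
    using a by (auto simp: f_def component_def extended_quaternions_def)
  then show "f \<in> (\<Pi>\<^sub>E \<xi> \<in> UNIV. component \<xi>)"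
    by auto
  have "?T \<subseteq> {..<d}"
  proof
    fix \<xi> assume "\<xi> \<in> ?T"
    then obtain n where "n mod d = \<xi>"
      by (auto simp: f_def extended_quaternions_def fun_eq_iff split: if_splits)
    then show "\<xi> \<in> {..<d}"
      using d by auto
  qed
  then show fin: "finite ?T"
    by (rule finite_subset) simp
  have "a n = (\<Sum>\<xi>\<in>?T. f \<xi> n)" for n
  proof -
    have "(\<Sum>\<xi>\<in>?T. f \<xi> n) = (\<Sum>\<xi>\<in>?T. if \<xi> = n mod d then a n else 0)"
      by (intro sum.cong) (auto simp: f_def)
    also have "\<dots> = a n"
      using fin by (auto simp: sum.delta) (auto simp: f_def extended_quaternions_def dest: fun_cong[where x = n])
    finally show ?thesis ..
  qed
  then show "a = (\<Oplus>\<^bsub>A\<^esub> \<xi> \<in> ?T. f \<xi>)"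
    using fin mem by (subst finsum_extended_quaternions) (auto simp: component_def)
qed

lemma component_mult:
  assumes a: "a \<in> component \<xi>" and b: "b \<in> component \<zeta>"
  shows "a \<otimes>\<^bsub>A\<^esub> b \<in> component (xor \<xi> \<zeta>)"
proof -
  interpret ring A by (rule extended_quaternions_ring)
  have closed: "a \<otimes>\<^bsub>A\<^esub> b \<in> carrier A"
    using a b by (auto simp: component_def)
  have deg: "\<xi> = m mod d \<and> \<zeta> = n mod d" if "a m * b n \<noteq> 0" for m n
    using that a b by (auto simp: component_def)
  have "n mod d = xor \<xi> \<zeta>" if nonzero: "(a \<otimes>\<^bsub>A\<^esub> b) n \<noteq> 0" for n
  proof (cases "n < 4")
    case True
    \<comment> \<open>Up to sign, the product of the basis vectors \<open>p\<close> and \<open>q\<close> of \<open>\<H>\<close> is the basis vector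
      \<open>xor p q\<close>.\<close>
    have "\<exists>p q. p < 4 \<and> q < 4 \<and> xor p q = n \<and> a p * b q \<noteq> 0"
    proof (rule ccontr)
      assume "\<not> ?thesis"
      then have *: "a p * b q = 0" if "p < 4" "q < 4" "xor p q = n" for p q
        using that by blast
      have "n = 0 \<or> n = 1 \<or> n = 2 \<or> n = 3"
        using True by auto
      then show False
        using nonzero
          *[of 0 0] *[of 0 1] *[of 0 2] *[of 0 3] *[of 1 0] *[of 1 1] *[of 1 2] *[of 1 3]
          *[of 2 0] *[of 2 1] *[of 2 2] *[of 2 3] *[of 3 0] *[of 3 1] *[of 3 2] *[of 3 3]
        by (elim disjE) (simp_all add: extended_quaternions_def del: mult_eq_0_iff)
    qed
    then show ?thesis
      using True d deg by fastforce
  next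
    case False
    consider "n < d" "a d * b n \<noteq> 0" | "n < d" "a n * b d \<noteq> 0" | "n = d" "a d * b d \<noteq> 0"
      using nonzero False
      by (cases "a d * b n = 0") (auto simp: extended_quaternions_def split: if_splits)
    then show ?thesis
      by cases (use deg in fastforce)+
  qed
  with closed show ?thesis
    by (simp add: component_def)
qed

lemma component_grading: "is_grading xor_monoid real_ring A component"
proof -
  have "\<exists>!f. f \<in> (\<Pi>\<^sub>E \<xi> \<in> UNIV. component \<xi>) \<and> finite {\<xi>. f \<xi> \<noteq> \<zero>\<^bsub>A\<^esub>} \<and>
      a = (\<Oplus>\<^bsub>A\<^esub> \<xi> \<in> {\<xi>. f \<xi> \<noteq> \<zero>\<^bsub>A\<^esub>}. f \<xi>)" if "a \<in> carrier A" for a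
    using homogeneous_parts_exist[OF that]
    by (intro ex1I[of _ "\<lambda>\<xi> n. if n mod d = \<xi> then a n else 0"] conjI)
       (auto intro: homogeneous_parts_unique)
  then show ?thesis
    by (auto simp: is_grading_def xor_monoid_def component_submodule component_mult)
qed

text \<open>
  The degree \<open>0\<close> is shared by the coordinates \<open>0\<close> and \<open>d\<close>, so the \<open>d + 1\<close> coordinates have only
  \<open>d\<close> degrees.
\<close>

lemma component_order: "has_order xor_monoid A component d"
proof -
  have "component \<xi> \<noteq> {\<zero>\<^bsub>A\<^esub>} \<longleftrightarrow> \<xi> < d" for \<xi>
  proof
    assume "\<xi> < d"
    then have "(\<lambda>n. if n = \<xi> then 1 else 0) \<in> component \<xi>"
      by (auto simp: component_def extended_quaternions_def)
    moreover have "(\<lambda>n. if n = \<xi> then 1 else 0) \<noteq> \<zero>\<^bsub>A\<^esub>"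
      by (auto simp: extended_quaternions_def fun_eq_iff)
    ultimately show "component \<xi> \<noteq> {\<zero>\<^bsub>A\<^esub>}"
      by blast
  next
    have "component \<xi> = {\<zero>\<^bsub>A\<^esub>}" if "\<not> \<xi> < d"
      using that d by (fastforce simp: component_def extended_quaternions_def)
    then show "component \<xi> \<noteq> {\<zero>\<^bsub>A\<^esub>} \<Longrightarrow> \<xi> < d"
      by blast
  qed
  then have "homogeneous_support xor_monoid A component = {..<d}"
    by (auto simp: homogeneous_support_def xor_monoid_def)
  then show ?thesis
    by (simp add: has_order_def)
qed

lemma neutral_component_central: "is_central A (component 0)"
proof -
  have "a \<otimes>\<^bsub>A\<^esub> b = b \<otimes>\<^bsub>A\<^esub> a" if "a \<in> component 0" for a b
  proof -
    have "a n = 0" if "0 < n" "n < d" for n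
      using that \<open>a \<in> component 0\<close> by (force simp: component_def)
    then have "a 1 = 0" "a 2 = 0" "a 3 = 0" "\<forall>n\<ge>4. n < d \<longrightarrow> a n = 0"
      using d by auto
    then show ?thesis
      by (auto simp: extended_quaternions_def fun_eq_iff algebra_simps)
  qed
  then show ?thesis
    by (auto simp: is_central_def component_def)
qed

section \<open>Left-normed commutators\<close>

abbreviation i_then_j :: "nat \<Rightarrow> nat \<Rightarrow> real" where
  "i_then_j m n \<equiv> if n = (if m = 1 then 1 else 2) then 1 else 0"

text \<open>
  Commutation with \<open>j\<close> maps \<open>a\<^sub>1 i + a\<^sub>3 k\<close> to \<open>-2 a\<^sub>3 i + 2 a\<^sub>1 k\<close>, so it preserves
  \<open>(a\<^sub>1, a\<^sub>3) \<noteq> (0, 0)\<close>. The claim is about both coordinates because the value alternates between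
  multiples of \<open>i\<close> and of \<open>k\<close>.
\<close>

lemma left_normed_commutator_i_j:
  assumes "m \<ge> 1"
  defines "c \<equiv> nc_eval A i_then_j (left_normed_commutator m)"
  shows "c \<in> carrier A \<and> (c 1 \<noteq> 0 \<or> c 3 \<noteq> 0)"
  using assms(1) unfolding c_def
proof (induction m rule: dec_induct)
  case base
  show ?case
    using d by (simp add: extended_quaternions_def)
next
  case (step m)
  interpret ring A by (rule extended_quaternions_ring)
  let ?c = "nc_eval A i_then_j (left_normed_commutator m)" and ?j = "i_then_j (Suc m)"
  have c: "?c \<in> carrier A" and j: "?j \<in> carrier A"
    using step d by (auto simp: extended_quaternions_def)
  have eval: "nc_eval A i_then_j (left_normed_commutator (Suc m)) =
      ?c \<otimes>\<^bsub>A\<^esub> ?j \<ominus>\<^bsub>A\<^esub> ?j \<otimes>\<^bsub>A\<^esub> ?c"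
    using step.hyps by (cases m) (simp_all add: nc_commutator_def)
  have "(?c \<otimes>\<^bsub>A\<^esub> ?j \<ominus>\<^bsub>A\<^esub> ?j \<otimes>\<^bsub>A\<^esub> ?c) 1 = - 2 * ?c 3"
    "(?c \<otimes>\<^bsub>A\<^esub> ?j \<ominus>\<^bsub>A\<^esub> ?j \<otimes>\<^bsub>A\<^esub> ?c) 3 = 2 * ?c 1"
    using step.hyps c j
    by (simp_all add: a_minus_extended_quaternions) (simp_all add: extended_quaternions_def)
  then show ?case
    unfolding eval using step.IH c j by auto
qed

lemma not_lie_nilpotent:
  assumes "m \<ge> 1"
  shows "\<not> polynomial_identity A (left_normed_commutator m)"
proof
  assume "polynomial_identity A (left_normed_commutator m)"
  moreover have "i_then_j n \<in> carrier A" for n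
    using d by (auto simp: extended_quaternions_def)
  ultimately have "nc_eval A i_then_j (left_normed_commutator m) = \<zero>\<^bsub>A\<^esub>"
    by (simp add: polynomial_identity_def)
  with left_normed_commutator_i_j[OF assms] show False
    by (simp add: extended_quaternions_def)
qed

end

theorem proposition3p9:
  fixes d :: nat
  assumes "d \<ge> 4"
  shows "\<exists>(S :: nat monoid) (K :: real ring) (A :: (real, nat \<Rightarrow> real) module) V.
           monoid_cancel S \<and>
           field K \<and>
           associative_algebra K A \<and>
           is_grading S K A V \<and>
           has_order S A V d \<and>
           is_central A (V \<one>\<^bsub>S\<^esub>) \<and>
           (\<forall>m\<ge>1. \<not> polynomial_identity A (left_normed_commutator m))"
proof (intro exI conjI allI impI)
  show "is_central (extended_quaternions d) (component d \<one>\<^bsub>xor_monoid\<^esub>)"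
    using neutral_component_central[OF assms] by (simp add: xor_monoid_def)
qed (fact xor_monoid_cancel real_ring_field extended_quaternions_algebra[OF assms]
    component_grading[OF assms] component_order[OF assms] | rule not_lie_nilpotent[OF assms])+

end
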